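(* Let $D$ and $G$ be two Seymour-tight orientations (with disjoint vertex sets), and let $f:D\to G$ be a digraph homomorphism. (1) Let $H$ be the orientation on $V(D)\cup V(G)$ whose arcs are the arcs of $D$, the arcs of $G$, and all arcs $d\to g$ with $d\in V(D)$, $g\in V(G)$ and $g\in N_1(G,f(d))$. Then $H$ is a Seymour-tight orientation. (2) Suppose that $f$ is a bijective homomorphism (bijective on vertices, so $|V(D)|=|V(G)|$). Let $O$ be the orientation on $V(D)\cup V(G)$ whose arcs are the arcs of $D$, the arcs of $G$, and all arcs $g\to d$ with $g\in V(G)$, $d\in V(D)$ and $f(d)\in N_1(G,g)$. Then $O$ is a Seymour-tight orientation.
   Context: All directed graphs are finite, with non-empty vertex set, and without loops or multiple arcs. An orientation is a directed graph with no directed cycle of length 2. For a directed graph $G$ and $v\in V(G)$, $N_1(G,v)=\{w : (v,w)\in E(G)\}$ and $N_2(G,v)=\{w\in V(G)\setminus(N_1(G,v)\cup\{v\}) : \exists u\in N_1(G,v),\ (u,w)\in E(G)\}$. An orientation $G$ is Seymour-tight if $|N_1(G,v)|=|N_2(G,v)|$ for all $v\in V(G)$. A digraph homomorphism $f:D\to G$ is a map $V(D)\to V(G)$ such that $(u,v)\in E(D)$ implies $(f(u),f(v))\in E(G)$. *)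

theory Defs
  imports "Graph_Theory.Pair_Digraph" "HOL-Library.FuncSet"
begin

text \<open>
  Arcs are ordered pairs, so multiple arcs are excluded by the representation; \<^locale>\<open>pair_digraph\<close>
  adds finiteness and the absence of loops. It admits the null graph, hence the assumption that
  the vertex set is non-empty.
\<close>

locale orientation = pair_digraph +
  assumes verts_nonempty: "pverts G \<noteq> {}"
    and no_two_cycle: "(u, v) \<in> parcs G \<Longrightarrow> (v, u) \<notin> parcs G"

definition N1 :: "'a pair_pre_digraph \<Rightarrow> 'a \<Rightarrow> 'a set" where
  "N1 G v = {w. (v, w) \<in> parcs G}"

definition N2 :: "'a pair_pre_digraph \<Rightarrow> 'a \<Rightarrow> 'a set" where
  "N2 G v = {w \<in> pverts G - (N1 G v \<union> {v}). \<exists>u \<in> N1 G v. (u, w) \<in> parcs G}"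

locale seymour_tight_orientation = orientation +
  assumes tight: "v \<in> pverts G \<Longrightarrow> card (N1 G v) = card (N2 G v)"

definition digraph_homomorphism ::
    "'a pair_pre_digraph \<Rightarrow> 'b pair_pre_digraph \<Rightarrow> ('a \<Rightarrow> 'b) \<Rightarrow> bool" where
  "digraph_homomorphism D G f \<longleftrightarrow>
     f \<in> pverts D \<rightarrow> pverts G \<and> (\<forall>u v. (u, v) \<in> parcs D \<longrightarrow> (f u, f v) \<in> parcs G)"

text \<open>
  In the two constructions below \<open>D\<close> and \<open>G\<close> live on the same vertex type and are meant to be used
  with disjoint vertex sets.
\<close>

definition forward_join ::
    "'a pair_pre_digraph \<Rightarrow> 'a pair_pre_digraph \<Rightarrow> ('a \<Rightarrow> 'a) \<Rightarrow> 'a pair_pre_digraph" where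
  "forward_join D G f =
     \<lparr> pverts = pverts D \<union> pverts G,
       parcs = parcs D \<union> parcs G \<union> {(d, g). d \<in> pverts D \<and> g \<in> pverts G \<and> g \<in> N1 G (f d)} \<rparr>"

definition backward_join ::
    "'a pair_pre_digraph \<Rightarrow> 'a pair_pre_digraph \<Rightarrow> ('a \<Rightarrow> 'a) \<Rightarrow> 'a pair_pre_digraph" where
  "backward_join D G f =
     \<lparr> pverts = pverts D \<union> pverts G,
       parcs = parcs D \<union> parcs G \<union> {(g, d). g \<in> pverts G \<and> d \<in> pverts D \<and> f d \<in> N1 G g} \<rparr>"

end

theory Submission
  imports Defs
begin

text \<open>
  By the homomorphism property, a walk of length two between \<open>D\<close> and \<open>G\<close> whose middle vertex
  \<open>d'\<close> lies in \<open>D\<close> can be rerouted through \<open>f d'\<close>, so the join creates no unexpected second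
  neighbours. Hence in the forward join both neighbourhoods of
  \<open>d \<in> D\<close> are the disjoint unions of those of \<open>d\<close> in \<open>D\<close> and of \<open>f d\<close> in \<open>G\<close>; in the backward join
  both neighbourhoods of \<open>g \<in> G\<close> are those in \<open>G\<close> together with their preimages under \<open>f\<close>, which
  doubles the cardinalities when \<open>f\<close> is bijective. All other neighbourhoods are unchanged.
\<close>

section \<open>First neighbourhoods in the joins\<close>

lemma N1_forward_join_left:
  assumes "pair_wf_digraph G" "pverts D \<inter> pverts G = {}" "v \<in> pverts D"
  shows "N1 (forward_join D G f) v = N1 D v \<union> N1 G (f v)"
proof -
  interpret G: pair_wf_digraph G by fact
  show ?thesis
    using assms(2,3) by (auto simp: N1_def forward_join_def dest: G.in_arcsD1 G.in_arcsD2)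
qed

lemma N1_forward_join_right:
  assumes "pair_wf_digraph D" "pverts D \<inter> pverts G = {}" "v \<in> pverts G"
  shows "N1 (forward_join D G f) v = N1 G v"
proof -
  interpret D: pair_wf_digraph D by fact
  show ?thesis
    using assms(2,3) by (auto simp: N1_def forward_join_def dest: D.in_arcsD1)
qed

lemma N1_backward_join_left:
  assumes "pair_wf_digraph G" "pverts D \<inter> pverts G = {}" "v \<in> pverts D"
  shows "N1 (backward_join D G f) v = N1 D v"
proof -
  interpret G: pair_wf_digraph G by fact
  show ?thesis
    using assms(2,3) by (auto simp: N1_def backward_join_def dest: G.in_arcsD1)
qed

lemma N1_backward_join_right:
  assumes "pair_wf_digraph D" "pverts D \<inter> pverts G = {}" "v \<in> pverts G"
  shows "N1 (backward_join D G f) v = N1 G v \<union> {d \<in> pverts D. f d \<in> N1 G v}"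
proof -
  interpret D: pair_wf_digraph D by fact
  show ?thesis
    using assms(2,3) by (auto simp: N1_def backward_join_def dest: D.in_arcsD1)
qed

text \<open>
  Without 2-cycles, \<open>v\<close> never lies in the union, so it need not be removed.
\<close>
lemma orientation_N2_eq_UN_N1:
  assumes "orientation G"
  shows "N2 G v = (\<Union>u \<in> N1 G v. N1 G u) - N1 G v"
proof -
  interpret orientation G by fact
  show ?thesis
    by (auto simp: N2_def N1_def dest: in_arcsD2 no_two_cycle)
qed

lemma N1_subset_pverts:
  assumes "pair_wf_digraph G"
  shows "N1 G v \<subseteq> pverts G"
proof -
  interpret pair_wf_digraph G by fact
  show ?thesis by (auto simp: N1_def dest: in_arcsD2)
qed

lemma digraph_homomorphism_N1:
  assumes "digraph_homomorphism D G f" "u \<in> N1 D v"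
  shows "f u \<in> N1 G (f v)"
  using assms by (auto simp: digraph_homomorphism_def N1_def)

section \<open>The joins are orientations\<close>

lemma orientation_forward_join:
  assumes "orientation D" "orientation G" "pverts D \<inter> pverts G = {}"
  shows "orientation (forward_join D G f)"
proof -
  interpret D: orientation D by fact
  interpret G: orientation G by fact
  let ?J = "forward_join D G f"
  note arcsD = D.in_arcsD1 D.in_arcsD2 G.in_arcsD1 G.in_arcsD2
  have wf: "u \<in> pverts ?J \<and> v \<in> pverts ?J" if "(u, v) \<in> parcs ?J" for u v
    using that by (auto simp: forward_join_def dest: arcsD)
  \<comment> \<open>All new arcs go from \<open>D\<close> to \<open>G\<close>, so by disjointness a
    2-cycle would lie entirely in \<open>D\<close> or entirely in \<open>G\<close>.\<close>
  have asym: "(v, u) \<notin> parcs ?J" if "(u, v) \<in> parcs ?J" for u v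
    using that assms(3) by (auto simp: forward_join_def dest: arcsD D.no_two_cycle G.no_two_cycle)
  show ?thesis
  proof unfold_locales
    show fin: "finite (pverts ?J)" and "pverts ?J \<noteq> {}"
      using D.verts_nonempty by (auto simp: forward_join_def D.pair_finite_verts G.pair_finite_verts)
    have "parcs ?J \<subseteq> pverts ?J \<times> pverts ?J"
      using wf by auto
    then show "finite (parcs ?J)"
      by (rule finite_subset) (use fin in simp)
  \<comment> \<open>Absence of loops also comes from \<open>asym\<close>, in the case
    \<open>u = v\<close>.\<close>
  qed (use wf asym in force)+
qed

lemma orientation_backward_join:
  assumes "orientation D" "orientation G" "pverts D \<inter> pverts G = {}"
  shows "orientation (backward_join D G f)"
proof -
  interpret D: orientation D by fact
  interpret G: orientation G by fact
  let ?J = "backward_join D G f"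
  note arcsD = D.in_arcsD1 D.in_arcsD2 G.in_arcsD1 G.in_arcsD2
  have wf: "u \<in> pverts ?J \<and> v \<in> pverts ?J" if "(u, v) \<in> parcs ?J" for u v
    using that by (auto simp: backward_join_def dest: arcsD)
  \<comment> \<open>Here all new arcs go from \<open>G\<close> to \<open>D\<close>, which again
    confines a 2-cycle to one side.\<close>
  have asym: "(v, u) \<notin> parcs ?J" if "(u, v) \<in> parcs ?J" for u v
    using that assms(3) by (auto simp: backward_join_def dest: arcsD D.no_two_cycle G.no_two_cycle)
  show ?thesis
  proof unfold_locales
    show fin: "finite (pverts ?J)" and "pverts ?J \<noteq> {}"
      using D.verts_nonempty by (auto simp: backward_join_def D.pair_finite_verts G.pair_finite_verts)
    have "parcs ?J \<subseteq> pverts ?J \<times> pverts ?J"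
      using wf by auto
    then show "finite (parcs ?J)"
      by (rule finite_subset) (use fin in simp)
  qed (use wf asym in force)+
qed

section \<open>Second neighbourhoods in the joins\<close>

context
  fixes D G :: "'a pair_pre_digraph" and f :: "'a \<Rightarrow> 'a"
  assumes orient: "orientation D" "orientation G"
    and disj: "pverts D \<inter> pverts G = {}"
begin

interpretation D: orientation D by (fact orient)
interpretation G: orientation G by (fact orient)

lemma N2_forward_join_left:
  assumes hom: "digraph_homomorphism D G f" and v: "v \<in> pverts D"
  shows "N2 (forward_join D G f) v = N2 D v \<union> N2 G (f v)"
proof -
  let ?H = "forward_join D G f"
  note subD = N1_subset_pverts[OF D.pair_wf_digraph_axioms]
  note subG = N1_subset_pverts[OF G.pair_wf_digraph_axioms]
  have N1v: "N1 ?H v = N1 D v \<union> N1 G (f v)"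
    using G.pair_wf_digraph_axioms disj v by (rule N1_forward_join_left)
  have "(\<Union>u \<in> N1 D v. N1 ?H u) = (\<Union>u \<in> N1 D v. N1 D u \<union> N1 G (f u))"
    by (intro SUP_cong refl N1_forward_join_left[OF G.pair_wf_digraph_axioms disj] subsetD[OF subD])
  moreover have "(\<Union>w \<in> N1 G (f v). N1 ?H w) = (\<Union>w \<in> N1 G (f v). N1 G w)"
    by (intro SUP_cong refl N1_forward_join_right[OF D.pair_wf_digraph_axioms disj] subsetD[OF subG])
  \<comment> \<open>The homomorphism enters here: for \<open>u\<close> in \<open>N1 D v\<close>, the
    vertex \<open>f u\<close> is itself one of the \<open>w\<close> on the right, so walks through
    \<open>u\<close> into \<open>G\<close> reach nothing new.\<close>
  moreover have "(\<Union>u \<in> N1 D v. N1 G (f u)) \<subseteq> (\<Union>w \<in> N1 G (f v). N1 G w)"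
    by (intro UN_least UN_upper digraph_homomorphism_N1[OF hom])
  ultimately have "(\<Union>u \<in> N1 ?H v. N1 ?H u)
      = (\<Union>u \<in> N1 D v. N1 D u) \<union> (\<Union>w \<in> N1 G (f v). N1 G w)"
    unfolding N1v UN_Un UN_Un_distrib by auto
  moreover have "(\<Union>u \<in> N1 D v. N1 D u) \<subseteq> pverts D" "(\<Union>w \<in> N1 G (f v). N1 G w) \<subseteq> pverts G"
    by (intro UN_least subD subG)+
  \<comment> \<open>With the cross terms empty, removing \<open>N1 D v \<union> N1 G (f v)\<close>
    acts separately on the \<open>D\<close> part and the \<open>G\<close> part.\<close>
  then have "(\<Union>u \<in> N1 D v. N1 D u) \<inter> N1 G (f v) = {}" "(\<Union>w \<in> N1 G (f v). N1 G w) \<inter> N1 D v = {}"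
    using disj subD[of v] subG[of "f v"] by blast+
  ultimately show ?thesis
    unfolding orientation_N2_eq_UN_N1[OF orientation_forward_join[OF orient disj]]
      orientation_N2_eq_UN_N1[OF orient(1)] orientation_N2_eq_UN_N1[OF orient(2)] N1v
    by auto
qed

text \<open>No arc of the forward join leaves \<open>G\<close>, so every walk starting at
  \<open>v\<close> stays in \<open>G\<close>.\<close>

lemma N2_forward_join_right:
  assumes "v \<in> pverts G"
  shows "N2 (forward_join D G f) v = N2 G v"
  unfolding orientation_N2_eq_UN_N1[OF orientation_forward_join[OF orient disj]]
    orientation_N2_eq_UN_N1[OF orient(2)] N1_forward_join_right[OF D.pair_wf_digraph_axioms disj assms]
  by (intro arg_cong2[where f = "(-)"] SUP_cong refl
    N1_forward_join_right[OF D.pair_wf_digraph_axioms disj]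
    subsetD[OF N1_subset_pverts[OF G.pair_wf_digraph_axioms]])

text \<open>Dually, no arc of the backward join leaves \<open>D\<close>.\<close>

lemma N2_backward_join_left:
  assumes "v \<in> pverts D"
  shows "N2 (backward_join D G f) v = N2 D v"
  unfolding orientation_N2_eq_UN_N1[OF orientation_backward_join[OF orient disj]]
    orientation_N2_eq_UN_N1[OF orient(1)] N1_backward_join_left[OF G.pair_wf_digraph_axioms disj assms]
  by (intro arg_cong2[where f = "(-)"] SUP_cong refl
    N1_backward_join_left[OF G.pair_wf_digraph_axioms disj]
    subsetD[OF N1_subset_pverts[OF D.pair_wf_digraph_axioms]])

lemma N2_backward_join_right:
  assumes hom: "digraph_homomorphism D G f" and v: "v \<in> pverts G"
  shows "N2 (backward_join D G f) v = N2 G v \<union> {d \<in> pverts D. f d \<in> N2 G v}"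
proof -
  let ?O = "backward_join D G f" and ?P = "\<lambda>S. {d \<in> pverts D. f d \<in> S}"
  note subD = N1_subset_pverts[OF D.pair_wf_digraph_axioms]
  note subG = N1_subset_pverts[OF G.pair_wf_digraph_axioms]
  have N1v: "N1 ?O v = N1 G v \<union> ?P (N1 G v)"
    using D.pair_wf_digraph_axioms disj v by (rule N1_backward_join_right)
  have "(\<Union>w \<in> N1 G v. N1 ?O w) = (\<Union>w \<in> N1 G v. N1 G w \<union> ?P (N1 G w))"
    by (intro SUP_cong refl N1_backward_join_right[OF D.pair_wf_digraph_axioms disj] subsetD[OF subG])
  moreover have "(\<Union>d \<in> ?P (N1 G v). N1 ?O d) = (\<Union>d \<in> ?P (N1 G v). N1 D d)"
    by (intro SUP_cong refl N1_backward_join_left[OF G.pair_wf_digraph_axioms disj]) simp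
  \<comment> \<open>A walk \<open>v\<close>, \<open>d\<close>, \<open>d'\<close> with both later
    vertices in \<open>D\<close> is matched by the walk \<open>v\<close>, \<open>f d\<close>,
    \<open>d'\<close>, since \<open>f d'\<close> is an out-neighbour of \<open>f d\<close>.\<close>
  moreover have "N1 D d \<subseteq> ?P (N1 G (f d))" for d
    using subD[of d] digraph_homomorphism_N1[OF hom] by blast
  then have "(\<Union>d \<in> ?P (N1 G v). N1 D d) \<subseteq> (\<Union>w \<in> N1 G v. ?P (N1 G w))"
    by fast
  ultimately have "(\<Union>u \<in> N1 ?O v. N1 ?O u)
      = (\<Union>w \<in> N1 G v. N1 G w) \<union> (\<Union>w \<in> N1 G v. ?P (N1 G w))"
    unfolding N1v UN_Un UN_Un_distrib by auto
  \<comment> \<open>Since the \<open>G\<close> part and its preimage \<open>?P\<close> lie in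
    disjoint vertex sets, and taking preimages commutes with unions and differences, the set
    difference splits.\<close>
  moreover have "(\<Union>w \<in> N1 G v. N1 G w) \<subseteq> pverts G"
    by (intro UN_least subG)
  ultimately show ?thesis
    using disj subG[of v]
    unfolding orientation_N2_eq_UN_N1[OF orientation_backward_join[OF orient disj]]
      orientation_N2_eq_UN_N1[OF orient(2)] N1v
    by auto
qed

end

section \<open>Cardinalities and tightness\<close>

lemma finite_N1:
  assumes "pair_fin_digraph G"
  shows "finite (N1 G v)"
proof -
  interpret pair_fin_digraph G by fact
  show ?thesis
    using N1_subset_pverts[OF pair_wf_digraph_axioms] pair_finite_verts by (rule finite_subset)
qed

lemma N2_subset_pverts: "N2 G v \<subseteq> pverts G"
  by (auto simp: N2_def)

lemma seymour_tight_forward_join: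
  assumes "seymour_tight_orientation D" "seymour_tight_orientation G"
    and disj: "pverts D \<inter> pverts G = {}" and hom: "digraph_homomorphism D G f"
  shows "seymour_tight_orientation (forward_join D G f)"
proof -
  interpret D: seymour_tight_orientation D by fact
  interpret G: seymour_tight_orientation G by fact
  note ax = D.orientation_axioms G.orientation_axioms disj
  interpret H: orientation "forward_join D G f"
    using ax by (rule orientation_forward_join)
  show ?thesis
  proof unfold_locales
    fix v assume "v \<in> pverts (forward_join D G f)"
    then consider "v \<in> pverts D" | "v \<in> pverts G"
      by (auto simp: forward_join_def)
    then show "card (N1 (forward_join D G f) v) = card (N2 (forward_join D G f) v)"
    proof cases
      case 1
      \<comment> \<open>Tightness of \<open>G\<close> is available only at its own vertices, and it
        is applied at \<open>f v\<close> to balance the second summands.\<close>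
      then have fv: "f v \<in> pverts G"
        using hom by (auto simp: digraph_homomorphism_def)
      have "card (N1 D v \<union> N1 G (f v)) = card (N1 D v) + card (N1 G (f v))"
        using disj N1_subset_pverts[OF D.pair_wf_digraph_axioms, of v]
          N1_subset_pverts[OF G.pair_wf_digraph_axioms, of "f v"]
        by (intro card_Un_disjoint finite_N1) (unfold_locales, unfold_locales, blast)
      moreover have "card (N2 D v \<union> N2 G (f v)) = card (N2 D v) + card (N2 G (f v))"
        using disj N2_subset_pverts[of D v] N2_subset_pverts[of G "f v"]
          D.pair_finite_verts G.pair_finite_verts
        by (intro card_Un_disjoint) (auto intro: finite_subset)
      ultimately show ?thesis
        using 1 fv N2_forward_join_left[OF ax hom] N1_forward_join_left[OF G.pair_wf_digraph_axioms disj]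
        by (simp add: D.tight G.tight)
    next
      case 2
      then show ?thesis
        using N2_forward_join_right[OF ax] N1_forward_join_right[OF D.pair_wf_digraph_axioms disj]
        by (simp add: G.tight)
    qed
  qed
qed

text \<open>The bijection restricts to one from the preimage of \<open>S\<close> onto
  \<open>S\<close>, and the preimage lies in \<open>A\<close>, away from \<open>S\<close>.\<close>

lemma card_Un_bij_betw_preimage:
  assumes "bij_betw f A B" "finite B" "A \<inter> B = {}" "S \<subseteq> B"
  shows "card (S \<union> {a \<in> A. f a \<in> S}) = 2 * card S"
proof -
  have bij: "bij_betw f {a \<in> A. f a \<in> S} S"
    using assms(1,4) by (auto simp: bij_betw_def inj_on_def)
  have fin: "finite S"
    using assms(2,4) by (rule rev_finite_subset)
  have "card (S \<union> {a \<in> A. f a \<in> S}) = card S + card {a \<in> A. f a \<in> S}"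
    using assms(3,4) fin bij_betw_finite[OF bij] by (intro card_Un_disjoint) auto
  then show ?thesis
    by (simp add: bij_betw_same_card[OF bij])
qed

lemma seymour_tight_backward_join:
  assumes "seymour_tight_orientation D" "seymour_tight_orientation G"
    and disj: "pverts D \<inter> pverts G = {}" and hom: "digraph_homomorphism D G f"
    and bij: "bij_betw f (pverts D) (pverts G)"
  shows "seymour_tight_orientation (backward_join D G f)"
proof -
  interpret D: seymour_tight_orientation D by fact
  interpret G: seymour_tight_orientation G by fact
  note ax = D.orientation_axioms G.orientation_axioms disj
  interpret O: orientation "backward_join D G f"
    using ax by (rule orientation_backward_join)
  \<comment> \<open>Used for both \<open>S = N1 G v\<close> and \<open>S = N2 G v\<close>, so the
    tightness equation of \<open>G\<close> at \<open>v\<close> is multiplied by two on each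
    side.\<close>
  have double: "card (S \<union> {d \<in> pverts D. f d \<in> S}) = 2 * card S" if "S \<subseteq> pverts G" for S
    using bij G.pair_finite_verts disj that by (rule card_Un_bij_betw_preimage)
  show ?thesis
  proof unfold_locales
    fix v assume "v \<in> pverts (backward_join D G f)"
    then consider "v \<in> pverts D" | "v \<in> pverts G"
      by (auto simp: backward_join_def)
    then show "card (N1 (backward_join D G f) v) = card (N2 (backward_join D G f) v)"
    proof cases
      case 1
      then show ?thesis
        using N2_backward_join_left[OF ax] N1_backward_join_left[OF G.pair_wf_digraph_axioms disj]
        by (simp add: D.tight)
    next
      case 2
      then show ?thesis
        using N2_backward_join_right[OF ax hom]
          N1_backward_join_right[OF D.pair_wf_digraph_axioms disj]
        by (simp add: G.tight double N2_subset_pverts N1_subset_pverts[OF G.pair_wf_digraph_axioms])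
    qed
  qed
qed

theorem lemma5p2:
  fixes D G :: "'a pair_pre_digraph" and f :: "'a \<Rightarrow> 'a"
  assumes "seymour_tight_orientation D"
    and "seymour_tight_orientation G"
    and "pverts D \<inter> pverts G = {}"
    and "digraph_homomorphism D G f"
  shows "seymour_tight_orientation (forward_join D G f) \<and>
    (bij_betw f (pverts D) (pverts G) \<longrightarrow> seymour_tight_orientation (backward_join D G f))"
  using seymour_tight_forward_join[OF assms] seymour_tight_backward_join[OF assms] by blast

end
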